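(* Let $G$ be an abelian group, let $\varphi\in\mathrm{End}(G)$ be surjective, let $H$ be a $\varphi$-invariant subgroup of $G$ (i.e. $\varphi(H)\subseteq H$), and let $\overline\varphi:G/H\to G/H$ be the endomorphism induced by $\varphi$. Then $s(\varphi)\geq s(\overline\varphi)$ and $ns(\varphi)\geq ns(\overline\varphi)$.
   Context: $\mathbb N=\{0,1,2,\dots\}$ and $\mathbb N_+=\mathbb N\setminus\{0\}$. For an endomorphism $\varphi$ of an abelian group $G$: $Q\mathrm{Per}(\varphi)$ is the set of $x\in G$ such that $\varphi^n(x)=\varphi^m(x)$ for some $n<m$ in $\mathbb N$. A string of $\varphi$ is a sequence $S=\{x_n\}_{n\in\mathbb N}$ of pairwise distinct elements of $G$ with $\varphi(x_n)=x_{n-1}$ for every $n\in\mathbb N_+$. A string is singular if $x_0\in Q\mathrm{Per}(\varphi)$, and non-singular otherwise. The numbers $s(\varphi)$ and $ns(\varphi)$ are the suprema of $|\mathcal F|$ over all families $\mathcal F$ of pairwise disjoint strings, respectively non-singular strings, of $\varphi$ in $G$ (disjointness refers to the underlying sets of elements). They take values in $\mathbb N\cup\{\infty\}$: each is set equal to $\infty$ whenever the supremum is infinite. *)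

theory Defs
  imports "HOL-Algebra.Coset" "HOL-Library.Extended_Nat"
begin

definition QPer :: "('a, 'b) monoid_scheme \<Rightarrow> ('a \<Rightarrow> 'a) \<Rightarrow> 'a set" where
  "QPer G \<phi> = {x \<in> carrier G. \<exists>n m. n < m \<and> (\<phi> ^^ n) x = (\<phi> ^^ m) x}"

definition strings :: "('a, 'b) monoid_scheme \<Rightarrow> ('a \<Rightarrow> 'a) \<Rightarrow> (nat \<Rightarrow> 'a) set" where
  "strings G \<phi> =
    {S. range S \<subseteq> carrier G \<and> inj S \<and> (\<forall>n>0. \<phi> (S n) = S (n - 1))}"

definition nonsingular_strings ::
  "('a, 'b) monoid_scheme \<Rightarrow> ('a \<Rightarrow> 'a) \<Rightarrow> (nat \<Rightarrow> 'a) set" where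
  "nonsingular_strings G \<phi> = {S \<in> strings G \<phi>. S 0 \<notin> QPer G \<phi>}"

(* All infinite cardinalities are collapsed to \<infinity>. *)
definition ecard :: "'a set \<Rightarrow> enat" where
  "ecard A = (if finite A then enat (card A) else \<infinity>)"

definition pairwise_disjoint_strings :: "(nat \<Rightarrow> 'a) set \<Rightarrow> bool" where
  "pairwise_disjoint_strings F \<longleftrightarrow> pairwise (\<lambda>S T. range S \<inter> range T = {}) F"

(* A supremum in enat is \<infinity> as soon as the cardinalities are unbounded, even if
   every single family is finite. *)
definition string_number :: "('a, 'b) monoid_scheme \<Rightarrow> ('a \<Rightarrow> 'a) \<Rightarrow> enat" where
  "string_number G \<phi> =
    (SUP F \<in> {F. F \<subseteq> strings G \<phi> \<and> pairwise_disjoint_strings F}. ecard F)"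

definition nonsingular_string_number ::
  "('a, 'b) monoid_scheme \<Rightarrow> ('a \<Rightarrow> 'a) \<Rightarrow> enat" where
  "nonsingular_string_number G \<phi> =
    (SUP F \<in> {F. F \<subseteq> nonsingular_strings G \<phi> \<and> pairwise_disjoint_strings F}. ecard F)"

(* The induced map on cosets. When H is a \<phi>-invariant subgroup, the image set below
   is a singleton for every coset C; see induced_endo_coset. *)
definition induced_endo ::
  "('a, 'b) monoid_scheme \<Rightarrow> 'a set \<Rightarrow> ('a \<Rightarrow> 'a) \<Rightarrow> 'a set \<Rightarrow> 'a set" where
  "induced_endo G H \<phi> C = the_elem ((\<lambda>x. H #>\<^bsub>G\<^esub> \<phi> x) ` C)"

lemma induced_endo_coset:
  assumes "comm_group G" and "\<phi> \<in> hom G G" and "subgroup H G" and "\<phi> ` H \<subseteq> H"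
    and "x \<in> carrier G"
  shows "induced_endo G H \<phi> (H #>\<^bsub>G\<^esub> x) = H #>\<^bsub>G\<^esub> \<phi> x"
proof -
  interpret comm_group G by fact
  have "H #>\<^bsub>G\<^esub> \<phi> y = H #>\<^bsub>G\<^esub> \<phi> x" if y: "y \<in> H #>\<^bsub>G\<^esub> x" for y
  proof -
    obtain h where h: "h \<in> H" "y = h \<otimes>\<^bsub>G\<^esub> x"
      using y unfolding r_coset_def by blast
    then have hG: "h \<in> carrier G"
      using assms(3) subgroup.mem_carrier by fast
    have "\<phi> y = \<phi> h \<otimes>\<^bsub>G\<^esub> \<phi> x"
      using assms(2,5) h hG by (simp add: hom_mult)
    moreover have "\<phi> h \<in> H"
      using assms(4) h by blast
    ultimately have "\<phi> y \<in> H #>\<^bsub>G\<^esub> \<phi> x"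
      unfolding r_coset_def by auto
    moreover have "\<phi> x \<in> carrier G"
      using assms(2,5) by (auto simp: hom_def)
    ultimately show ?thesis
      using repr_independence[of "\<phi> y" H "\<phi> x"] assms(3) by simp
  qed
  moreover have "x \<in> H #>\<^bsub>G\<^esub> x"
    using assms(3,5) rcos_self by blast
  ultimately have "(\<lambda>y. H #>\<^bsub>G\<^esub> \<phi> y) ` (H #>\<^bsub>G\<^esub> x) = {H #>\<^bsub>G\<^esub> \<phi> x}"
    by blast
  then show ?thesis
    by (simp add: induced_endo_def)
qed

lemma induced_endo_hom:
  assumes "comm_group G" and "\<phi> \<in> hom G G" and "subgroup H G" and "\<phi> ` H \<subseteq> H"
  shows "induced_endo G H \<phi> \<in> hom (G Mod H) (G Mod H)"
proof -
  interpret comm_group G by fact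
  interpret N: normal H G
    using assms(3) subgroup_imp_normal by blast
  have \<phi>: "\<phi> x \<in> carrier G" if "x \<in> carrier G" for x
    using assms(2) that by (auto simp: hom_def)
  show ?thesis
    using \<phi> assms(2)
    by (auto intro!: homI simp: carrier_FactGroup N.rcos_sum induced_endo_coset[OF assms]
        hom_mult)
qed

end

theory Submission
  imports Defs "HOL-Algebra.Generated_Groups" "HOL-Computational_Algebra.Primes"
begin

text \<open>
  The strings of the quotient are never compared with strings of \<open>G\<close>; in each of three cases one
  side of the inequality is extreme.

  If some point is not quasi-periodic, there are infinitely many pairwise disjoint non-singular
  strings in \<open>G\<close> (\<open>nonsingular_string_number_of_nonperiodic\<close>), so both numbers of \<open>\<phi>\<close> are infinite.
  Since \<open>\<phi>\<close> is onto, every non-quasi-periodic point starts a string, and two such strings are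
  disjoint as soon as the forward orbits of their starting points never meet. So it is enough to
  find infinitely many non-quasi-periodic points whose orbits are pairwise disjoint. Suppose there
  is no such sequence, and view \<open>G\<close> additively as a module over the polynomial ring \<open>\<int>[X]\<close>, where
  \<open>X\<close> acts as \<open>\<phi>\<close>. The points \<open>x + \<phi>\<^sup>d x\<close> cannot all be non-quasi-periodic with
  pairwise disjoint orbits, which yields a monic integer polynomial annihilating \<open>x\<close> (\<open>integral_relation\<close>). Hence a torsion point
  lies in a finite \<open>\<phi>\<close>-invariant subgroup, and non-quasi-periodicity passes from \<open>x\<close> to all its
  positive multiples (\<open>QPer_of_power\<close>). If \<open>x\<close> is not quasi-periodic, then the multiples
  \<open>2\<^sup>r x\<close> cannot have pairwise disjoint orbits either, and neither can the multiples \<open>3\<^sup>t x\<close>;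
  that gives relations \<open>2\<^sup>r \<phi>\<^sup>i x = 2\<^sup>s \<phi>\<^sup>j x\<close> and \<open>3\<^sup>t \<phi>\<^sup>k x = 3\<^sup>u \<phi>\<^sup>l x\<close> with \<open>r \<noteq> s\<close> and
  \<open>t \<noteq> u\<close>. Combining suitable powers of the two cancels the exponents of \<open>\<phi>\<close>
  and leaves \<open>a \<phi>\<^sup>N x = b \<phi>\<^sup>N x\<close> with \<open>a \<noteq> b\<close> by unique factorisation. So \<open>\<phi>\<^sup>N x\<close> is
  torsion, and \<open>x\<close> is quasi-periodic after all (\<open>no_orbit_antichain_imp_QPer\<close>).

  If every point is quasi-periodic, so is every coset, and the quotient has no non-singular string.
  If moreover \<open>\<phi>\<close> has a nonzero kernel, a string ending in the kernel can be
  combined with its own shifts to produce infinitely many disjoint strings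
  (\<open>string_number_of_kernel\<close>). Otherwise \<open>\<phi>\<close> is injective, every point of \<open>G\<close> and hence every coset
  is periodic, and the quotient has no string at all (\<open>strings_empty_of_periodic\<close>).
\<close>

section \<open>Extreme values of the string numbers\<close>

lemma disjoint_string_sequence:
  fixes T :: "nat \<Rightarrow> nat \<Rightarrow> 'a"
  assumes "\<And>i j. i \<noteq> j \<Longrightarrow> range (T i) \<inter> range (T j) = {}"
  shows "pairwise_disjoint_strings (range T)" "ecard (range T) = \<infinity>"
proof -
  have "inj T"
  proof (rule injI)
    fix i j
    assume "T i = T j"
    then have "range (T i) \<inter> range (T j) \<noteq> {}" by simp
    then show "i = j" using assms by blast
  qed
  then show "ecard (range T) = \<infinity>"
    using finite_imageD infinite_UNIV_nat by (auto simp: ecard_def)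
  show "pairwise_disjoint_strings (range T)"
    using assms unfolding pairwise_disjoint_strings_def pairwise_def by (metis imageE)
qed

lemma string_number_infinity:
  assumes "\<And>i::nat. T i \<in> strings G \<phi>"
    and "\<And>i j. i \<noteq> j \<Longrightarrow> range (T i) \<inter> range (T j) = {}"
  shows "string_number G \<phi> = \<infinity>"
proof -
  have "ecard (range T) \<le> string_number G \<phi>"
    unfolding string_number_def
  proof (rule SUP_upper)
    show "range T \<in> {F. F \<subseteq> strings G \<phi> \<and> pairwise_disjoint_strings F}"
      using assms(1) disjoint_string_sequence(1)[OF assms(2)] by auto
  qed
  then show ?thesis
    using disjoint_string_sequence(2)[of T] assms(2) by simp
qed

lemma nonsingular_string_number_infinity:
  assumes "\<And>i::nat. T i \<in> nonsingular_strings G \<phi>"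
    and "\<And>i j. i \<noteq> j \<Longrightarrow> range (T i) \<inter> range (T j) = {}"
  shows "nonsingular_string_number G \<phi> = \<infinity>"
proof -
  have "ecard (range T) \<le> nonsingular_string_number G \<phi>"
    unfolding nonsingular_string_number_def
  proof (rule SUP_upper)
    show "range T \<in> {F. F \<subseteq> nonsingular_strings G \<phi> \<and> pairwise_disjoint_strings F}"
      using assms(1) disjoint_string_sequence(1)[OF assms(2)] by auto
  qed
  then show ?thesis
    using disjoint_string_sequence(2)[of T] assms(2) by simp
qed

lemma nonsingular_string_number_le: "nonsingular_string_number G \<phi> \<le> string_number G \<phi>"
  unfolding nonsingular_string_number_def string_number_def
  by (rule SUP_subset_mono) (auto simp: nonsingular_strings_def)

lemma string_number_zero:
  assumes "strings G \<phi> = {}"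
  shows "string_number G \<phi> = 0"
proof -
  have "{F. F \<subseteq> strings G \<phi> \<and> pairwise_disjoint_strings F} = {{}}"
    using assms by (auto simp: pairwise_disjoint_strings_def)
  then show ?thesis
    unfolding string_number_def by (simp add: ecard_def enat_0)
qed

lemma nonsingular_string_number_zero:
  assumes "nonsingular_strings G \<phi> = {}"
  shows "nonsingular_string_number G \<phi> = 0"
proof -
  have "{F. F \<subseteq> nonsingular_strings G \<phi> \<and> pairwise_disjoint_strings F} = {{}}"
    using assms by (auto simp: pairwise_disjoint_strings_def)
  then show ?thesis
    unfolding nonsingular_string_number_def by (simp add: ecard_def enat_0)
qed

section \<open>Iterates and quasi-periodic points\<close>

locale comm_group_endo = comm_group G for G (structure) +
  fixes \<phi> :: "'a \<Rightarrow> 'a"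
  assumes endo: "\<phi> \<in> hom G G"
begin

lemma iter_closed [simp, intro]: "x \<in> carrier G \<Longrightarrow> (\<phi> ^^ n) x \<in> carrier G"
  by (induction n) (simp_all add: hom_in_carrier[OF endo])

lemma iter_mult:
  "\<lbrakk>x \<in> carrier G; y \<in> carrier G\<rbrakk> \<Longrightarrow> (\<phi> ^^ n) (x \<otimes> y) = (\<phi> ^^ n) x \<otimes> (\<phi> ^^ n) y"
  by (induction n) (simp_all add: hom_mult[OF endo])

lemma iter_group_hom: "group_hom G G (\<phi> ^^ n)"
  by unfold_locales (simp add: hom_def iter_mult)

lemma iter_one [simp]: "(\<phi> ^^ n) \<one> = \<one>"
  using group_hom.hom_one[OF iter_group_hom] .

lemma iter_pow: "x \<in> carrier G \<Longrightarrow> (\<phi> ^^ n) (x [^] k) = (\<phi> ^^ n) x [^] (k::nat)"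
  by (rule group_hom.hom_nat_pow[OF iter_group_hom])

lemma iter_iter: "(\<phi> ^^ m) ((\<phi> ^^ n) x) = (\<phi> ^^ (m + n)) x"
  by (simp add: funpow_add)

lemma QPerI: "\<lbrakk>x \<in> carrier G; (\<phi> ^^ n) x = (\<phi> ^^ m) x; n \<noteq> m\<rbrakk> \<Longrightarrow> x \<in> QPer G \<phi>"
  unfolding QPer_def by (cases n m rule: linorder_cases) (auto, metis)

lemma QPer_of_iterate:
  assumes "x \<in> carrier G" "(\<phi> ^^ k) x \<in> QPer G \<phi>"
  shows "x \<in> QPer G \<phi>"
proof -
  obtain n m where "n < m" "(\<phi> ^^ n) ((\<phi> ^^ k) x) = (\<phi> ^^ m) ((\<phi> ^^ k) x)"
    using assms(2) unfolding QPer_def by blast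
  then show ?thesis
    using assms(1) QPerI[of x "n + k" "m + k"] by (simp add: iter_iter)
qed

section \<open>Points whose orbits meet\<close>

definition orbits_meet :: "'a \<Rightarrow> 'a \<Rightarrow> bool" where
  "orbits_meet x y \<longleftrightarrow> (\<exists>i j. (\<phi> ^^ i) x = (\<phi> ^^ j) y)"

text \<open>
  This is the hypothesis to be refuted when some point is not quasi-periodic: the non-quasi-periodic
  points fall into finitely many classes under meeting of orbits, expressed by sequences
  so that it can be applied directly to a family of elements built from one point.
\<close>

definition no_orbit_antichain :: bool where
  "no_orbit_antichain \<longleftrightarrow> (\<forall>y :: nat \<Rightarrow> 'a. range y \<subseteq> carrier G - QPer G \<phi> \<longrightarrow>
     (\<exists>i j. i < j \<and> orbits_meet (y i) (y j)))"

lemma leading_iterate_in_span: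
  assumes x: "x \<in> carrier G" and "0 < d"
    and eq: "(\<phi> ^^ i) x \<otimes> (\<phi> ^^ (i + d)) x = (\<phi> ^^ j) x \<otimes> (\<phi> ^^ k) x"
    and "j < i + d" "k < i + d"
  shows "(\<phi> ^^ (i + d)) x \<in> generate G ((\<lambda>l. (\<phi> ^^ l) x) ` {..<i + d})"
proof -
  let ?V = "generate G ((\<lambda>l. (\<phi> ^^ l) x) ` {..<i + d})"
  have V: "(\<phi> ^^ l) x \<in> ?V" if "l < i + d" for l
    using that by (intro generate.incl) auto
  have V': "inv ((\<phi> ^^ l) x) \<in> ?V" if "l < i + d" for l
    using that by (intro generate.inv) auto
  have "(\<phi> ^^ (i + d)) x = inv ((\<phi> ^^ i) x) \<otimes> ((\<phi> ^^ j) x \<otimes> (\<phi> ^^ k) x)"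
    using x eq by (metis inv_solve_left iter_closed m_closed)
  also have "\<dots> \<in> ?V"
    using assms by (intro generate.eng V V') auto
  finally show ?thesis .
qed

text \<open>
  The points \<open>x + \<phi>\<^sup>d x\<close> with \<open>d > 0\<close> are images of \<open>x\<close> under the polynomials \<open>1 + X\<^sup>d\<close>. A meeting of
  two of their orbits, or of one orbit with itself, reads \<open>\<phi>\<^sup>i x + \<phi>\<^sup>i\<^sup>+\<^sup>d x = \<phi>\<^sup>j x + \<phi>\<^sup>j\<^sup>+\<^sup>e x\<close>. All
  coefficients being \<open>1\<close>, the term of highest degree can be solved for; the two top terms
  can cancel only if \<open>\<phi>\<^sup>i x = \<phi>\<^sup>j x\<close> remains with \<open>i \<noteq> j\<close>, which
  makes \<open>x\<close> quasi-periodic and is itself a relation of the required kind.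
\<close>

lemma integral_relation:
  assumes few: no_orbit_antichain and x: "x \<in> carrier G"
  obtains D where "(\<phi> ^^ D) x \<in> generate G ((\<lambda>l. (\<phi> ^^ l) x) ` {..<D})"
proof -
  have "\<exists>D. (\<phi> ^^ D) x \<in> generate G ((\<lambda>l. (\<phi> ^^ l) x) ` {..<D})"
  proof (cases "x \<in> QPer G \<phi>")
    case True
    then obtain n m where "n < m" "(\<phi> ^^ n) x = (\<phi> ^^ m) x"
      unfolding QPer_def by blast
    then show ?thesis
      by (metis generate.incl image_eqI lessThan_iff)
  next
    case False
    have *: ?thesis
      if "(\<phi> ^^ i) (x \<otimes> (\<phi> ^^ d) x) = (\<phi> ^^ j) (x \<otimes> (\<phi> ^^ e) x)"
        and "0 < d" "0 < e" "(i, d) \<noteq> (j, e)" for i j d e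
    proof -
      have eq: "(\<phi> ^^ i) x \<otimes> (\<phi> ^^ (i + d)) x = (\<phi> ^^ j) x \<otimes> (\<phi> ^^ (j + e)) x"
        using that(1) x by (simp add: iter_mult iter_iter)
      consider "j + e < i + d" | "i + d < j + e" | "i + d = j + e" by linarith
      then show ?thesis
      proof cases
        case 1
        then show ?thesis
          using leading_iterate_in_span[OF x that(2) eq] by auto
      next
        case 2
        then show ?thesis
          using leading_iterate_in_span[OF x that(3) eq[symmetric]] by auto
      next
        case 3
        then have "(\<phi> ^^ i) x = (\<phi> ^^ j) x"
          using eq x by simp
        then show ?thesis
          using 3 that(4) False QPerI[OF x, of i j] by auto
      qed
    qed
    show ?thesis
    proof (cases "\<exists>d>0. x \<otimes> (\<phi> ^^ d) x \<in> QPer G \<phi>")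
      case True
      then obtain d n m where "0 < d" "n < m"
        "(\<phi> ^^ n) (x \<otimes> (\<phi> ^^ d) x) = (\<phi> ^^ m) (x \<otimes> (\<phi> ^^ d) x)"
        unfolding QPer_def by blast
      then show ?thesis
        using *[of n d m d] by simp
    next
      case False
      then have "range (\<lambda>d. x \<otimes> (\<phi> ^^ Suc d) x) \<subseteq> carrier G - QPer G \<phi>"
        using x by (auto simp del: funpow.simps)
      then obtain d e where "d < e" "orbits_meet (x \<otimes> (\<phi> ^^ Suc d) x) (x \<otimes> (\<phi> ^^ Suc e) x)"
        using few unfolding no_orbit_antichain_def by blast
      then obtain i j where
        "(\<phi> ^^ i) (x \<otimes> (\<phi> ^^ Suc d) x) = (\<phi> ^^ j) (x \<otimes> (\<phi> ^^ Suc e) x)"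
        unfolding orbits_meet_def by blast
      then show ?thesis
        using *[of i "Suc d" j "Suc e"] \<open>d < e\<close> by simp
    qed
  qed
  then show thesis
    using that by blast
qed

section \<open>Torsion and quasi-periodicity\<close>

text \<open>Adding one generator replaces the subgroup by its product with a finite cyclic group.\<close>

lemma finite_generate_torsion:
  assumes "finite F" "F \<subseteq> carrier G" "0 < (c::nat)" "\<And>x. x \<in> F \<Longrightarrow> x [^] c = \<one>"
  shows "finite (generate G F)"
proof -
  have "\<exists>W. finite W \<and> subgroup W G \<and> F \<subseteq> W"
    using assms(1,2,4)
  proof (induction F)
    case empty
    then show ?case
      using triv_subgroup by blast
  next
    case (insert x F)
    then obtain W where W: "finite W" "subgroup W G" "F \<subseteq> W" by auto
    have x: "x \<in> carrier G" "x [^] c = \<one>"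
      using insert.prems by auto
    have "generate G {x} = {x [^] k |k. k \<in> (UNIV :: int set)}"
      using generate_pow[OF x(1)] .
    also have "\<dots> \<subseteq> (\<lambda>k. x [^] k) ` {0..<int c}"
    proof clarify
      fix k :: int
      have "x [^] k = x [^] (int c * (k div int c) + k mod int c)"
        by simp
      also have "\<dots> = (x [^] int c) [^] (k div int c) \<otimes> x [^] (k mod int c)"
        using x(1) by (simp only: int_pow_mult int_pow_pow)
      also have "\<dots> = x [^] (k mod int c)"
        using x by (simp add: int_pow_int)
      finally show "x [^] k \<in> (\<lambda>k. x [^] k) ` {0..<int c}"
        using assms(3) by auto
    qed
    finally have fin: "finite (generate G {x})"
      using finite_subset by blast
    have sub: "subgroup (generate G {x}) G"
      using x by (intro generate_is_subgroup) auto
    have "finite (generate G {x} <#> W)"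
      using fin W(1) unfolding set_mult_def by auto
    moreover have "subgroup (generate G {x} <#> W) G"
      using mult_subgroups[OF sub W(2)] .
    moreover have "insert x F \<subseteq> generate G {x} <#> W"
    proof -
      have "x \<otimes> \<one> \<in> generate G {x} <#> W"
        using W(2) unfolding set_mult_def
        by (blast intro: generate.incl subgroup.one_closed)
      moreover have "y \<in> generate G {x} <#> W" if "y \<in> F" for y
      proof -
        have "\<one> \<otimes> y \<in> generate G {x} <#> W"
          using W(3) that unfolding set_mult_def by (blast intro: generate.one)
        then show ?thesis
          using that insert.prems(1) by auto
      qed
      ultimately show ?thesis
        using x(1) by auto
    qed
    ultimately show ?case by blast
  qed
  then show ?thesis
    using generate_subgroup_incl finite_subset by metis
qed

text \<open>
  By the monic relation, the first iterates of \<open>u\<close>, up to the degree of the relation, generate an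
  invariant subgroup; it is finite because its finitely many generators have bounded order.
\<close>

lemma torsion_finite_invariant_subgroup:
  assumes few: no_orbit_antichain and u: "u \<in> carrier G" "u [^] c = \<one>" "0 < (c::nat)"
  obtains W where "finite W" "subgroup W G" "u \<in> W" "\<phi> ` W \<subseteq> W"
proof -
  obtain D where D: "(\<phi> ^^ D) u \<in> generate G ((\<lambda>l. (\<phi> ^^ l) u) ` {..<D})"
    using integral_relation[OF few u(1)] .
  define E where "E = (\<lambda>l. (\<phi> ^^ l) u) ` {..<D}"
  define F where "F = (\<lambda>l. (\<phi> ^^ l) u) ` {..D}"
  have F: "finite F" "F \<subseteq> carrier G" and E: "E \<subseteq> carrier G"
    using u(1) by (auto simp: E_def F_def)
  have shift: "\<phi> ` E \<subseteq> F"
  proof -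
    have "(\<phi> ^^ Suc l) u \<in> F" if "l < D" for l
      using that unfolding F_def by (intro imageI) simp
    then show ?thesis
      by (auto simp: E_def)
  qed
  have "(\<phi> ^^ 0) u \<in> F"
    unfolding F_def by (intro imageI) simp
  then have uF: "u \<in> F" by simp
  have "x [^] c = \<one>" if "x \<in> F" for x
    using that u by (auto simp: F_def simp flip: iter_pow)
  then have fin: "finite (generate G F)"
    using finite_generate_torsion[OF F u(3)] by blast
  interpret \<phi>: group_hom G G \<phi>
    using iter_group_hom[of 1] by simp
  have F': "F \<subseteq> generate G F"
    by (auto intro: generate.incl)
  have "\<phi> ((\<phi> ^^ D) u) \<in> \<phi> ` generate G E"
    using D by (auto simp: E_def)
  also have "\<dots> \<subseteq> generate G F"
    using \<phi>.generate_img[OF E] mono_generate[OF shift] by simp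
  finally have "\<phi> ((\<phi> ^^ D) u) \<in> generate G F" .
  moreover have "F = insert ((\<phi> ^^ D) u) E"
    by (simp add: E_def F_def lessThan_Suc flip: lessThan_Suc_atMost)
  ultimately have "\<phi> ` F \<subseteq> generate G F"
    using shift F' by blast
  then have "generate G (\<phi> ` F) \<subseteq> generate G F"
    using generate_subgroup_incl generate_is_subgroup[OF F(2)] by blast
  then have "\<phi> ` generate G F \<subseteq> generate G F"
    using \<phi>.generate_img[OF F(2)] by simp
  then show thesis
    using that[of "generate G F"] fin generate_is_subgroup[OF F(2)] F' uF by blast
qed

text \<open>
  If \<open>\<phi>\<^sup>i\<close> and \<open>\<phi>\<^sup>j\<close> agree at \<open>c x\<close>, their difference \<open>u\<close> at \<open>x\<close> is a torsion element, and lies in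
  some finite invariant subgroup \<open>W\<close>. Modulo \<open>W\<close> the point \<open>\<phi>\<^sup>i x\<close> is fixed by \<open>\<phi>\<^sup>j\<^sup>-\<^sup>i\<close>, so infinitely
  many iterates of \<open>x\<close> lie in one finite coset and two of them coincide.
\<close>

lemma QPer_of_power:
  assumes few: no_orbit_antichain and x: "x \<in> carrier G"
    and c: "0 < (c::nat)" and xc: "x [^] c \<in> QPer G \<phi>"
  shows "x \<in> QPer G \<phi>"
proof -
  obtain i j where ij: "i < j" "(\<phi> ^^ i) (x [^] c) = (\<phi> ^^ j) (x [^] c)"
    using xc unfolding QPer_def by blast
  define u where "u = (\<phi> ^^ j) x \<otimes> inv ((\<phi> ^^ i) x)"
  have u: "u \<in> carrier G"
    using x by (simp add: u_def)
  have "u [^] c = \<one>"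
    using x ij(2) by (simp add: u_def nat_pow_distrib nat_pow_inv iter_pow)
  then obtain W where W: "finite W" "subgroup W G" "u \<in> W" "\<phi> ` W \<subseteq> W"
    using torsion_finite_invariant_subgroup[OF few u _ c] by blast
  interpret W: subgroup W G by fact
  have W': "(\<phi> ^^ n) w \<in> W" if "w \<in> W" for n w
    using that W(4) by (induction n) auto
  define p where "p = j - i"
  have step: "(\<phi> ^^ p) ((\<phi> ^^ i) x) = u \<otimes> (\<phi> ^^ i) x"
    using x ij(1) by (simp add: u_def p_def iter_iter m_assoc)
  have "(\<phi> ^^ (p * n + i)) x \<in> W #> (\<phi> ^^ i) x" for n
  proof (induction n)
    case 0
    then show ?case
      using x by (simp add: rcos_self W.subgroup_axioms)
  next
    case (Suc n)
    then obtain w where w: "w \<in> W" "(\<phi> ^^ (p * n + i)) x = w \<otimes> (\<phi> ^^ i) x"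
      unfolding r_coset_def by blast
    have "(\<phi> ^^ (p * Suc n + i)) x = (\<phi> ^^ p) (w \<otimes> (\<phi> ^^ i) x)"
      using w(2) by (metis (no_types, opaque_lifting) add.assoc iter_iter mult_Suc_right)
    also have "\<dots> = ((\<phi> ^^ p) w \<otimes> u) \<otimes> (\<phi> ^^ i) x"
      using w(1) x u W.mem_carrier by (simp add: iter_mult step m_assoc del: funpow.simps)
    also have "\<dots> \<in> W #> (\<phi> ^^ i) x"
      using W' w(1) W(3) unfolding r_coset_def by blast
    finally show ?case .
  qed
  then have "range (\<lambda>n. (\<phi> ^^ (p * n + i)) x) \<subseteq> W #> (\<phi> ^^ i) x"
    by (rule image_subsetI)
  moreover have "finite (W #> (\<phi> ^^ i) x)"
    using W(1) by (simp add: r_coset_def)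
  ultimately have "finite (range (\<lambda>n. (\<phi> ^^ (p * n + i)) x))"
    by (rule finite_subset)
  then have "\<not> inj (\<lambda>n. (\<phi> ^^ (p * n + i)) x)"
    using finite_imageD by blast
  then obtain n m where "n \<noteq> m" "(\<phi> ^^ (p * n + i)) x = (\<phi> ^^ (p * m + i)) x"
    unfolding inj_def by blast
  then show ?thesis
    using QPerI[OF x] ij(1) by (auto simp: p_def)
qed

section \<open>Two-term relations\<close>

text \<open>In module terms, \<open>a X\<^sup>i - b X\<^sup>j\<close> annihilates \<open>x\<close>.\<close>

definition binomial_relation :: "'a \<Rightarrow> nat \<Rightarrow> nat \<Rightarrow> nat \<Rightarrow> nat \<Rightarrow> bool" where
  "binomial_relation x i a j b \<longleftrightarrow> (\<phi> ^^ i) (x [^] a) = (\<phi> ^^ j) (x [^] b)"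

lemma binomial_relation_sym: "binomial_relation x i a j b \<Longrightarrow> binomial_relation x j b i a"
  by (simp add: binomial_relation_def)

lemma binomial_relation_mult:
  assumes x: "x \<in> carrier G" and "binomial_relation x i a j b" "binomial_relation x k c l d"
  shows "binomial_relation x (i + k) (a * c) (j + l) (b * d)"
proof -
  have "(\<phi> ^^ (i + k)) (x [^] (a * c)) = (\<phi> ^^ k) ((\<phi> ^^ i) (x [^] a) [^] c)"
    using x by (simp add: iter_pow nat_pow_pow iter_iter add.commute)
  also have "\<dots> = (\<phi> ^^ j) ((\<phi> ^^ k) (x [^] c) [^] b)"
    using x assms(2) by (simp add: binomial_relation_def iter_pow nat_pow_pow iter_iter ac_simps)
  also have "\<dots> = (\<phi> ^^ (j + l)) (x [^] (b * d))"
    using x assms(3) by (simp add: binomial_relation_def iter_pow nat_pow_pow iter_iter ac_simps)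
  finally show ?thesis
    by (simp add: binomial_relation_def)
qed

lemma binomial_relation_power:
  assumes x: "x \<in> carrier G" and "binomial_relation x i a j b"
  shows "binomial_relation x (n * i) (a ^ n) (n * j) (b ^ n)"
proof (induction n)
  case (Suc n)
  then show ?case
    using binomial_relation_mult[OF x assms(2) Suc] by simp
qed (simp add: binomial_relation_def)

text \<open>Here \<open>\<phi>\<^sup>n x\<close> is killed by \<open>\<bar>a - b\<bar>\<close>, and \<open>\<one>\<close> is quasi-periodic.\<close>

lemma binomial_relation_same_degree:
  assumes few: no_orbit_antichain and x: "x \<in> carrier G"
    and rel: "binomial_relation x n a n b" and "a \<noteq> b"
  shows "x \<in> QPer G \<phi>"
proof -
  have *: "x \<in> QPer G \<phi>" if "binomial_relation x n a n b" "a < b" for a b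
  proof -
    have y: "(\<phi> ^^ n) x \<in> carrier G"
      using x by simp
    have "(\<phi> ^^ n) x [^] a \<otimes> (\<phi> ^^ n) x [^] (b - a) = (\<phi> ^^ n) x [^] b"
      using that(2) nat_pow_mult[OF y, of a "b - a"] by simp
    also have "\<dots> = (\<phi> ^^ n) x [^] a"
      using that(1) x by (simp add: binomial_relation_def iter_pow)
    finally have "(\<phi> ^^ n) x [^] (b - a) = \<one>"
      using y by simp
    moreover have "\<one> \<in> QPer G \<phi>"
      using iter_one[of 0] iter_one[of 1] by (intro QPerI[of _ 0 1]) simp_all
    ultimately have "(\<phi> ^^ n) x \<in> QPer G \<phi>"
      using QPer_of_power[OF few y, of "b - a"] that(2) by simp
    then show ?thesis
      using QPer_of_iterate x by blast
  qed
  show ?thesis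
    using *[of a b] *[of b a] rel binomial_relation_sym[OF rel] \<open>a \<noteq> b\<close>
    by (cases a b rule: linorder_cases) auto
qed

lemma binomial_relation_of_powers:
  assumes few: no_orbit_antichain and x: "x \<in> carrier G" "x \<notin> QPer G \<phi>" and b: "0 < b"
  obtains i j r s where "r < s" "binomial_relation x i (b ^ r) j (b ^ s)"
proof -
  have "range (\<lambda>r. x [^] (b ^ r)) \<subseteq> carrier G - QPer G \<phi>"
    using QPer_of_power[OF few x(1), of "b ^ _"] x b by auto
  then obtain r s where "r < s" "orbits_meet (x [^] (b ^ r)) (x [^] (b ^ s))"
    using few unfolding no_orbit_antichain_def by blast
  then show thesis
    using that unfolding orbits_meet_def binomial_relation_def by blast
qed

lemma prime_powers_independent:
  fixes r s n t u :: nat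
  assumes "r \<noteq> s" "0 < n"
  shows "(2::nat) ^ (r * n) * 3 ^ t \<noteq> 2 ^ (s * n) * 3 ^ u"
proof
  assume eq: "(2::nat) ^ (r * n) * 3 ^ t = 2 ^ (s * n) * 3 ^ u"
  have "multiplicity 2 ((2::nat) ^ k * 3 ^ l) = k" for k l
    by (intro multiplicity_eqI) auto
  then have "r * n = s * n"
    using eq by metis
  then show False
    using assms by simp
qed

text \<open>
  A relation between multiples by powers of \<open>2\<close> and one by powers of \<open>3\<close> shift the degree by
  \<open>i - j\<close> and \<open>k - l\<close>. Taking the \<open>\<bar>k - l\<bar>\<close>-th power of the former and the \<open>\<bar>i - j\<bar>\<close>-th power of
  the latter, reversed if necessary, cancels these shifts. The coefficients stay
  different since the powers of \<open>2\<close> in them do.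
\<close>

lemma no_orbit_antichain_imp_QPer:
  assumes few: no_orbit_antichain and x: "x \<in> carrier G"
  shows "x \<in> QPer G \<phi>"
proof (rule ccontr)
  assume nq: "x \<notin> QPer G \<phi>"
  obtain i j r s where two: "r < s" "binomial_relation x i (2 ^ r) j (2 ^ s)"
    by (rule binomial_relation_of_powers[OF few x nq, of 2]) auto
  obtain k l t u where three: "t < u" "binomial_relation x k (3 ^ t) l (3 ^ u)"
    by (rule binomial_relation_of_powers[OF few x nq, of 3]) auto
  \<comment> \<open>Otherwise the power of the \<open>2\<close>-relation taken below would be the trivial one.\<close>
  have ne: "k \<noteq> l"
    using binomial_relation_same_degree[OF few x, of k "3 ^ t" "3 ^ u"] three nq by auto
  have clash: False
    if rel: "binomial_relation x k' (3 ^ t') l' (3 ^ u')"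
      and n: "0 < n" "n * i + m * k' = n * j + m * l'" for k' l' t' u' n m
  proof -
    have "binomial_relation x (n * i + m * k') ((2 ^ r) ^ n * (3 ^ t') ^ m)
            (n * j + m * l') ((2 ^ s) ^ n * (3 ^ u') ^ m)"
      using two(2) rel x by (intro binomial_relation_mult binomial_relation_power)
    moreover have "((2::nat) ^ r) ^ n * (3 ^ t') ^ m \<noteq> (2 ^ s) ^ n * (3 ^ u') ^ m"
      using prime_powers_independent[of r s n] two(1) n(1) by (simp flip: power_mult)
    ultimately show False
      using binomial_relation_same_degree[OF few x] n(2) nq by metis
  qed
  define n where "n = nat \<bar>int k - int l\<bar>"
  define m where "m = nat \<bar>int i - int j\<bar>"
  have "0 < n"
    using ne by (simp add: n_def)
  have "int n * (int i - int j) = int m * (int l - int k) \<or>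
        int n * (int i - int j) = int m * (int k - int l)"
    by (auto simp: n_def m_def abs_if algebra_simps)
  then have "int (n * i + m * k) = int (n * j + m * l) \<or> int (n * i + m * l) = int (n * j + m * k)"
    by (auto simp: algebra_simps)
  then have "n * i + m * k = n * j + m * l \<or> n * i + m * l = n * j + m * k"
    by (simp only: of_nat_eq_iff)
  then show False
    using clash[OF three(2) \<open>0 < n\<close>] clash[OF binomial_relation_sym[OF three(2)] \<open>0 < n\<close>] by blast
qed

end

section \<open>Strings of a surjective endomorphism\<close>

locale comm_group_surj_endo = comm_group_endo +
  assumes surj: "\<phi> ` carrier G = carrier G"
begin

definition backward :: "'a \<Rightarrow> nat \<Rightarrow> 'a" where
  "backward x n = (inv_into (carrier G) \<phi> ^^ n) x"

lemma backward_0 [simp]: "backward x 0 = x"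
  by (simp add: backward_def)

lemma backward_closed [simp]: "x \<in> carrier G \<Longrightarrow> backward x n \<in> carrier G"
  unfolding backward_def using surj by (induction n) (auto intro: inv_into_into)

lemma backward_Suc [simp]: "x \<in> carrier G \<Longrightarrow> \<phi> (backward x (Suc n)) = backward x n"
  using backward_closed[of x n] surj by (simp add: backward_def f_inv_into_f)

lemma iter_backward: "x \<in> carrier G \<Longrightarrow> (\<phi> ^^ n) (backward x (n + k)) = backward x k"
proof (induction n)
  case (Suc n)
  then show ?case
    by (simp add: funpow_Suc_right del: funpow.simps)
qed simp

lemma iter_backward_self: "x \<in> carrier G \<Longrightarrow> (\<phi> ^^ n) (backward x n) = x"
  using iter_backward[of x n 0] by simp

lemma iter_backward_past:
  "x \<in> carrier G \<Longrightarrow> (\<phi> ^^ (m + n)) (backward x n) = (\<phi> ^^ m) x"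
  by (simp add: iter_backward_self flip: iter_iter)

lemma backward_string:
  assumes x: "x \<in> carrier G" and np: "\<And>p. 0 < p \<Longrightarrow> (\<phi> ^^ p) x \<noteq> x"
  shows "backward x \<in> strings G \<phi>"
proof -
  have "backward x n \<noteq> backward x m" if "n < m" for n m
  proof
    assume eq: "backward x n = backward x m"
    have "(\<phi> ^^ (m - n)) x = (\<phi> ^^ m) (backward x n)"
      using iter_backward_past[OF x, of "m - n" n] that by simp
    then show False
      using eq np[of "m - n"] that iter_backward_self[OF x] by simp
  qed
  then have "inj (backward x)"
    by (metis injI linorder_cases)
  moreover have "\<phi> (backward x n) = backward x (n - 1)" if "0 < n" for n
    using that x by (cases n) auto
  ultimately show ?thesis
    using x by (auto simp: strings_def)
qed

text \<open>
  Strings obtained by choosing preimages of starting points \<open>y i\<close> are disjoint once the orbits of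
  the \<open>y i\<close> do not meet: a common element would flow forward into both orbits.
\<close>

lemma nonsingular_string_number_of_nonperiodic:
  assumes "QPer G \<phi> \<noteq> carrier G"
  shows "nonsingular_string_number G \<phi> = \<infinity>"
proof -
  have "\<not> no_orbit_antichain"
    using no_orbit_antichain_imp_QPer assms by (auto simp: QPer_def)
  then obtain y :: "nat \<Rightarrow> 'a" where y: "\<And>i. y i \<in> carrier G" "\<And>i. y i \<notin> QPer G \<phi>"
    and "\<And>i j. i < j \<Longrightarrow> \<not> orbits_meet (y i) (y j)"
    unfolding no_orbit_antichain_def by blast
  then have apart: "\<not> orbits_meet (y i) (y j)" if "i \<noteq> j" for i j
    using that unfolding orbits_meet_def by (metis linorder_cases)
  have str: "backward (y i) \<in> nonsingular_strings G \<phi>" for i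
    using y[of i] QPerI[of "y i" _ 0] unfolding nonsingular_strings_def
    by (auto intro!: backward_string)
  have disj: "range (backward (y i)) \<inter> range (backward (y j)) = {}" if "i \<noteq> j" for i j
  proof -
    have "orbits_meet (y i) (y j)" if "backward (y i) n = backward (y j) m" for n m
    proof -
      have "(\<phi> ^^ m) (y i) = (\<phi> ^^ (m + n)) (backward (y i) n)"
        using iter_backward_past y(1) by simp
      also have "\<dots> = (\<phi> ^^ n) (y j)"
        using iter_backward_past[of "y j" n m] y(1) that by (simp add: add.commute)
      finally show ?thesis
        unfolding orbits_meet_def by blast
    qed
    then show ?thesis
      using apart[OF that] by blast
  qed
  show ?thesis
    using nonsingular_string_number_infinity[OF str disj] .
qed

text \<open>
  Let \<open>y\<^sub>n\<close> be the \<open>n\<close>-th chosen preimage of the kernel element \<open>y\<close>. The strings are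
  \<open>n \<mapsto> y\<^sub>n\<^sub>+\<^sub>j\<^sub>+\<^sub>1 + y\<^sub>n\<close>. The number of steps after which an element of such a string
  becomes trivial reveals \<open>n + j\<close>; subtracting \<open>y\<^sub>n\<^sub>+\<^sub>j\<^sub>+\<^sub>1\<close> then leaves \<open>y\<^sub>n\<close>, which reveals \<open>n\<close>. So all
  elements of all these strings are different.
\<close>

lemma string_number_of_kernel:
  assumes y: "y \<in> carrier G" "\<phi> y = \<one>" "y \<noteq> \<one>"
  shows "string_number G \<phi> = \<infinity>"
proof -
  define T where "T j n = backward y (n + Suc j) \<otimes> backward y n" for j n
  have above: "(\<phi> ^^ k) (backward y n) = \<one>" if less: "n < k" for n k
  proof -
    obtain d where "k = Suc d + n"
      using less_imp_Suc_add[OF less] by (auto simp: add.commute)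
    then have "(\<phi> ^^ k) (backward y n) = (\<phi> ^^ d) (\<phi> y)"
      using iter_backward_past[OF y(1), of "Suc d" n] by (simp add: funpow_swap1)
    then show ?thesis
      using y(2) by simp
  qed
  have T: "T j n \<in> carrier G" for j n
    using y(1) by (simp add: T_def)
  have value_top: "(\<phi> ^^ (n + Suc j)) (T j n) = y" for j n
    using y(1) by (simp add: T_def iter_mult iter_backward_self above del: funpow.simps add_Suc_right)
  have value_above: "(\<phi> ^^ k) (T j n) = \<one>" if "n + j + 1 < k" for j n k
    using y(1) that by (simp add: T_def iter_mult above)
  have bw_inj: "n = m" if "backward y n = backward y m" for n m
    using that above[of n m] above[of m n] iter_backward_self[OF y(1)] y(3)
    by (cases n m rule: linorder_cases) metis+
  have T_inj: "i = j \<and> n = m" if eq: "T i n = T j m" for i j n m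
  proof -
    have "n + i = m + j"
      using value_top[of n i] value_top[of m j] value_above[of n i "m + Suc j"]
        value_above[of m j "n + Suc i"] eq y(3)
      by (cases "n + i" "m + j" rule: linorder_cases) auto
    moreover have "n = m"
    proof (rule bw_inj)
      show "backward y n = backward y m"
        using eq y(1) calculation by (simp add: T_def)
    qed
    ultimately show ?thesis by simp
  qed
  have "T j \<in> strings G \<phi>" for j
  proof -
    have "\<phi> (T j (Suc n)) = T j n" for n
      using y(1) endo backward_Suc[OF y(1), of n] backward_Suc[OF y(1), of "n + Suc j"]
      by (simp add: T_def hom_mult del: backward_Suc)
    then have "\<phi> (T j n) = T j (n - 1)" if "0 < n" for n
      using that by (metis Suc_diff_1)
    then show ?thesis
      using T T_inj by (auto simp: strings_def intro!: injI)
  qed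
  then show ?thesis
    using T_inj by (intro string_number_infinity[of T]) blast+
qed

end

text \<open>
  If \<open>S 0\<close> and \<open>S p\<close> have periods \<open>p\<close> and \<open>q\<close>, then \<open>q p\<close> steps starting at \<open>S p\<close> lead back to \<open>S p\<close>;
  but the first \<open>p\<close> of them reach \<open>S 0\<close>, and the remaining multiple of \<open>p\<close> ends there as well.
\<close>

lemma strings_empty_of_periodic:
  assumes per: "\<And>x. x \<in> carrier G \<Longrightarrow> \<exists>p>0. (\<phi> ^^ p) x = x"
  shows "strings G \<phi> = {}"
proof -
  have False if S: "S \<in> strings G \<phi>" for S
  proof -
    have inj: "inj S" and car: "S n \<in> carrier G" and "0 < n \<Longrightarrow> \<phi> (S n) = S (n - 1)" for n
      using S by (auto simp: strings_def)
    then have step: "\<phi> (S (Suc n)) = S n" for n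
      by (metis diff_Suc_1 zero_less_Suc)
    have down: "(\<phi> ^^ n) (S (n + k)) = S k" for n k
      by (induction n) (simp_all add: funpow_Suc_right step del: funpow.simps)
    obtain p where p: "0 < p" "(\<phi> ^^ p) (S 0) = S 0"
      using per car by blast
    obtain q where q: "0 < q" "(\<phi> ^^ q) (S p) = S p"
      using per car by blast
    have iter_p: "(\<phi> ^^ (p * n)) (S 0) = S 0" for n
      by (induction n) (simp_all add: funpow_add p)
    have iter_q: "(\<phi> ^^ (q * n)) (S p) = S p" for n
      by (induction n) (simp_all add: funpow_add q)
    have "q * p = p * (q - 1) + p"
      using q(1) by (cases q) auto
    then have "S p = (\<phi> ^^ (p * (q - 1))) ((\<phi> ^^ p) (S p))"
      using iter_q[of p] by (simp add: funpow_add)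
    also have "\<dots> = S 0"
      using down[of p 0] iter_p by simp
    finally show False
      using inj p(1) by (simp add: inj_eq)
  qed
  then show ?thesis by blast
qed

section \<open>Comparison with the quotient\<close>

lemma induced_endo_iter:
  assumes "comm_group G" "\<phi> \<in> hom G G" "subgroup H G" "\<phi> ` H \<subseteq> H" "x \<in> carrier G"
  shows "(induced_endo G H \<phi> ^^ n) (H #>\<^bsub>G\<^esub> x) = H #>\<^bsub>G\<^esub> (\<phi> ^^ n) x"
proof -
  interpret comm_group_endo G \<phi>
    using assms(1,2) by (simp add: comm_group_endo_def comm_group_endo_axioms_def)
  show ?thesis
    using assms(5) by (induction n) (simp_all add: induced_endo_coset[OF assms(1-4)])
qed

theorem theorem4p9:
  fixes G :: "('a, 'b) monoid_scheme" and \<phi> :: "'a \<Rightarrow> 'a" and H :: "'a set"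
  assumes "comm_group G"
    and "\<phi> \<in> hom G G"
    and "\<phi> ` carrier G = carrier G"
    and "subgroup H G"
    and "\<phi> ` H \<subseteq> H"
  shows "string_number G \<phi> \<ge> string_number (G Mod H) (induced_endo G H \<phi>)
    \<and> nonsingular_string_number G \<phi> \<ge> nonsingular_string_number (G Mod H) (induced_endo G H \<phi>)"
proof -
  interpret comm_group_surj_endo G \<phi>
    using assms(1-3) by (simp add: comm_group_surj_endo_def comm_group_endo_def
        comm_group_endo_axioms_def comm_group_surj_endo_axioms_def)
  let ?Q = "G Mod H" and ?\<psi> = "induced_endo G H \<phi>"
  have iter: "(?\<psi> ^^ n) (H #>\<^bsub>G\<^esub> x) = H #>\<^bsub>G\<^esub> (\<phi> ^^ n) x" if "x \<in> carrier G" for x n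
    using induced_endo_iter[OF assms(1,2,4,5) that] .
  have cosets: "\<exists>x\<in>carrier G. C = H #>\<^bsub>G\<^esub> x" if "C \<in> carrier ?Q" for C
    using that by (auto simp: FactGroup_def RCOSETS_def)
  show ?thesis
  proof (cases "QPer G \<phi> = carrier G")
    case False
    then have "nonsingular_string_number G \<phi> = \<infinity>"
      by (rule nonsingular_string_number_of_nonperiodic)
    then show ?thesis
      using nonsingular_string_number_le[of G \<phi>] by simp
  next
    case True
    have "C \<in> QPer ?Q ?\<psi>" if C: "C \<in> carrier ?Q" for C
    proof -
      obtain x where x: "x \<in> carrier G" "C = H #>\<^bsub>G\<^esub> x"
        using cosets[OF C] by blast
      then obtain n m where "n < m" "(\<phi> ^^ n) x = (\<phi> ^^ m) x"
        using True unfolding QPer_def by blast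
      then have "(?\<psi> ^^ n) C = (?\<psi> ^^ m) C"
        using x iter by simp
      then show ?thesis
        using C \<open>n < m\<close> unfolding QPer_def by blast
    qed
    moreover have "S 0 \<in> carrier ?Q - QPer ?Q ?\<psi>" if "S \<in> nonsingular_strings ?Q ?\<psi>" for S
      using that unfolding nonsingular_strings_def strings_def by blast
    ultimately have "nonsingular_strings ?Q ?\<psi> = {}"
      by blast
    then have ns: "nonsingular_string_number ?Q ?\<psi> = 0"
      by (rule nonsingular_string_number_zero)
    have s: "string_number ?Q ?\<psi> \<le> string_number G \<phi>"
    proof (cases "\<exists>y\<in>carrier G. \<phi> y = \<one>\<^bsub>G\<^esub> \<and> y \<noteq> \<one>\<^bsub>G\<^esub>")
      case True
      then show ?thesis
        using string_number_of_kernel by auto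
    next
      case False
      interpret group_hom G G \<phi>
        using iter_group_hom[of 1] by simp
      have inj: "inj_on \<phi> (carrier G)"
        using False by (auto simp: inj_on_one_iff)
      have per: "\<exists>p>0. (\<phi> ^^ p) x = x" if x: "x \<in> carrier G" for x
      proof -
        obtain n m where nm: "n < m" "(\<phi> ^^ n) x = (\<phi> ^^ m) x"
          using True x unfolding QPer_def by blast
        have "inj_on (\<phi> ^^ n) (carrier G)"
          by (induction n) (auto simp: inj_on_def intro: inj_onD[OF inj])
        moreover have "(\<phi> ^^ n) x = (\<phi> ^^ n) ((\<phi> ^^ (m - n)) x)"
          using nm by (simp add: iter_iter)
        ultimately have "(\<phi> ^^ (m - n)) x = x"
          using x by (metis inj_onD iter_closed)
        then show ?thesis
          using nm(1) by (intro exI[of _ "m - n"]) simp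
      qed
      have "\<exists>p>0. (?\<psi> ^^ p) C = C" if "C \<in> carrier ?Q" for C
        using cosets[OF that] per iter by metis
      then have "strings ?Q ?\<psi> = {}"
        by (rule strings_empty_of_periodic)
      then show ?thesis
        by (simp add: string_number_zero)
    qed
    show ?thesis
      using s ns by simp
  qed
qed

end
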